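(* Let $N\ge 3$ robotic agents rigidly grasp an object. Let agent $i$ have end-effector position $p_i\in\mathbb{R}^3$ and orientation $R_i\in\mathsf{SO}(3)$, let $x=(x_1,\dots,x_N)\in\mathsf{SE}(3)^N$ with $x_i=(p_i,R_i)$, let $p_O\in\mathbb{R}^3$ be the position of the object's center of mass, and let $G(x)\in\mathbb{R}^{6\times 6N}$ be the associated grasp matrix. Let the agents be modeled by the framework $(\mathcal{K}_N,p,R)$ in $\mathsf{SE}(3)$ on the complete graph $\mathcal{K}_N$, with distance-and-bearing rigidity matrix $\mathcal{R}_{\mathcal{K}_N}(x)$. Suppose that $$\mathrm{rank}(\mathcal{R}_{\mathcal{K}_N}(x))=\max_{y\in\mathsf{SE}(3)^N}\mathrm{rank}(\mathcal{R}_{\mathcal{K}_N}(y)).$$ Then $$\mathrm{null}(G(x))=\mathrm{range}(\mathcal{R}_{\mathcal{K}_N}(x)^\top).$$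
   Context: For $a\in\mathbb{R}^3$, $S(a)$ is the skew-symmetric matrix with $S(a)b=a\times b$; for nonzero $y\in\mathbb{R}^n$, $P_r(y)=I_n-\frac{yy^\top}{\|y\|^2}$. Grasp matrix: $G(x)=[J_{O_1}^\top,\dots,J_{O_N}^\top]\in\mathbb{R}^{6\times 6N}$ with $J_{O_i}=\begin{bmatrix} I_3 & -S(p_i-p_O)\\ 0_{3\times3} & I_3\end{bmatrix}$. Rigidity matrix: all configurations considered (including those in the maximum) have pairwise distinct positions, so that bearings are defined. Let $\mathcal{N}=\{1,\dots,N\}$; the complete graph $\mathcal{K}_N$ has edge set $\mathcal{E}=\{(i,j)\in\mathcal{N}^2: i\ne j\}$, and $\mathcal{E}_u=\{(i,j)\in\mathcal{E}: i<j\}$. The distance and bearing functions are $\gamma_{e,d}=\frac12\|p_i-p_j\|^2$ for $e=(i,j)\in\mathcal{E}_u$ and $\gamma_{e,b}=R_i^\top\frac{p_j-p_i}{\|p_i-p_j\|}$ for $e=(i,j)\in\mathcal{E}$. The distance-and-bearing rigidity matrix $\mathcal{R}_{\mathcal{K}_N}(x)\in\mathbb{R}^{(|\mathcal{E}_u|+3|\mathcal{E}|)\times 6N}$ is the matrix of the rate of change of the stacked vector of all $\gamma_{e,d}$ ($e\in\mathcal{E}_u$) and $\gamma_{e,b}$ ($e\in\mathcal{E}$), with respect to $v=[\dot p_1^\top,\omega_1^\top,\dots,\dot p_N^\top,\omega_N^\top]^\top$, where $\dot R_i=S(\omega_i)R_i$. Explicitly, its columns are grouped in $N$ blocks of six (three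 for $\dot p_k$, then three for $\omega_k$). For each $e=(i,j)\in\mathcal{E}_u$ it has one row whose block $i$ is $[(p_i-p_j)^\top\ \ 0_{1\times3}]$, whose block $j$ is $[(p_j-p_i)^\top\ \ 0_{1\times3}]$, and whose other blocks are zero. For each $e=(i,j)\in\mathcal{E}$ it has three rows whose block $i$ is $\left[-\frac{P_r(\gamma_{e,b})}{\|p_j-p_i\|}R_i^\top\ \ S(\gamma_{e,b})R_i^\top\right]$, whose block $j$ is $\left[\frac{P_r(\gamma_{e,b})}{\|p_j-p_i\|}R_i^\top\ \ 0_{3\times3}\right]$, and whose other blocks are zero. The ordering of the edges is arbitrary but fixed. *)

theory Defs
  imports "HOL-Analysis.Analysis"
begin

definition skew :: "real^3 \<Rightarrow> real^3^3" where
  "skew a = matrix (cross3 a)"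

lemma skew_mult_vec: "skew a *v b = cross3 a b"
proof -
  have "linear (cross3 a)"
    by (intro linearI) (simp_all add: cross3_simps)
  then show ?thesis
    by (simp add: skew_def matrix_works)
qed

definition proj_compl :: "real^'n \<Rightarrow> real^'n^'n" where
  "proj_compl y = mat 1 - (1 / (norm y)\<^sup>2) *\<^sub>R ((columnvector y :: real^1^'n) ** rowvector y)"

text \<open>
  A pose is a pair of a position and an orientation. Six-dimensional spaces are
  indexed by the sum type \<open>3 + 3\<close>: the left summand belongs to the linear part, the
  right one to the angular part. The type \<open>'n \<times> (3 + 3)\<close> indexes the \<open>6N\<close>
  coordinates of a stacked velocity, where \<open>N\<close> is the cardinality of \<open>'n\<close>.
\<close>

type_synonym pose = "(real^3) \<times> (real^3^3)"

definition SE3 :: "pose set" where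
  "SE3 = {(p, R). rotation_matrix R}"

definition configurations :: "('n \<Rightarrow> pose) set" where
  "configurations = {x. (\<forall>i. x i \<in> SE3) \<and> inj (\<lambda>i. fst (x i))}"

text \<open>
  Since a matrix is a vector of rows, \<open>stack\<close> concatenates two vectors, and also puts
  one matrix on top of another.
\<close>

definition stack :: "'a^'m \<Rightarrow> 'a^'n \<Rightarrow> 'a^('m + 'n)" where
  "stack a b = (\<chi> k. case k of Inl i \<Rightarrow> a $ i | Inr j \<Rightarrow> b $ j)"

definition beside :: "'a^'m^'r \<Rightarrow> 'a^'n^'r \<Rightarrow> 'a^('m + 'n)^'r" where
  "beside A B = (\<chi> r. stack (A $ r) (B $ r))"

definition object_jacobian :: "real^3 \<Rightarrow> real^3 \<Rightarrow> real^(3 + 3)^(3 + 3)" where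
  "object_jacobian p\<^sub>O p =
     stack (beside (mat 1) (- skew (p - p\<^sub>O)))
           (beside 0       (mat 1))"

definition grasp_matrix :: "real^3 \<Rightarrow> ('n \<Rightarrow> pose) \<Rightarrow> real^('n::finite \<times> (3 + 3))^(3 + 3)" where
  "grasp_matrix p\<^sub>O x =
     (\<chi> r c. case c of (i, l) \<Rightarrow> transpose (object_jacobian p\<^sub>O (fst (x i))) $ r $ l)"

definition edges :: "('n \<times> 'n) set" where
  "edges = {(i, j). i \<noteq> j}"

definition undirected_edges :: "('n::linorder \<times> 'n) set" where
  "undirected_edges = {(i, j). i < j}"

definition bearing :: "('n \<Rightarrow> pose) \<Rightarrow> 'n \<times> 'n \<Rightarrow> real^3" where
  "bearing x = (\<lambda>(i, j).
     transpose (snd (x i)) *v ((1 / norm (fst (x i) - fst (x j))) *\<^sub>R (fst (x j) - fst (x i))))"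

definition distance_block :: "('n \<Rightarrow> pose) \<Rightarrow> 'n \<times> 'n \<Rightarrow> 'n \<Rightarrow> real^(3 + 3)" where
  "distance_block x = (\<lambda>(i, j) k.
     if k = i then stack (fst (x i) - fst (x j)) 0
     else if k = j then stack (fst (x j) - fst (x i)) 0
     else 0)"

definition bearing_block :: "('n \<Rightarrow> pose) \<Rightarrow> 'n \<times> 'n \<Rightarrow> 'n \<Rightarrow> real^(3 + 3)^3" where
  "bearing_block x = (\<lambda>(i, j) k.
     let \<gamma> = bearing x (i, j);
         A = ((1 / norm (fst (x j) - fst (x i))) *\<^sub>R proj_compl \<gamma>) ** transpose (snd (x i))
     in if k = i then beside (- A) (skew \<gamma> ** transpose (snd (x i)))
        else if k = j then beside A 0
        else 0)"

text \<open>
  The arguments \<open>\<epsilon>\<^sub>d\<close> and \<open>\<epsilon>\<^sub>b\<close> enumerate \<open>undirected_edges\<close> and \<open>edges\<close>; they fix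
  the labelling of the rows.
\<close>

definition rigidity_matrix ::
  "('d \<Rightarrow> 'n \<times> 'n) \<Rightarrow> ('b \<Rightarrow> 'n \<times> 'n) \<Rightarrow> ('n \<Rightarrow> pose) \<Rightarrow>
     real^('n::finite \<times> (3 + 3))^('d::finite + 'b::finite \<times> 3)" where
  "rigidity_matrix \<epsilon>\<^sub>d \<epsilon>\<^sub>b x =
     stack (\<chi> e c. case c of (k, l) \<Rightarrow> distance_block x (\<epsilon>\<^sub>d e) k $ l)
           (\<chi> r c. case r of (e, m) \<Rightarrow> case c of (k, l) \<Rightarrow> bearing_block x (\<epsilon>\<^sub>b e) k $ m $ l)"

end

theory Submission
  imports Defs
begin

text \<open>
  Write \<open>u\<^sub>i, w\<^sub>i\<close> for the linear and angular velocities of agent \<open>i\<close>. The distance row and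
  the bearing rows of an edge fix the components of \<open>u\<^sub>j - u\<^sub>i\<close> along and across
  \<open>p\<^sub>j - p\<^sub>i\<close>, so the kernel of the rigidity matrix consists of the velocities with
  \<open>u\<^sub>j - u\<^sub>i = w\<^sub>i \<times> (p\<^sub>j - p\<^sub>i)\<close> for all \<open>i \<noteq> j\<close>. It always contains the rigid motions,
  which form the six-dimensional range of the transposed grasp matrix, and it equals that range
  when no two agents are collinear with all the others. As \<open>N \<ge> 3\<close>, such a configuration
  exists; hence the kernel has dimension at most six at a configuration of maximal rank and is
  there the space of rigid motions. The claim follows by taking orthogonal complements.
\<close>

text \<open>As a simplification rule it would turn \<open>transpose A *v z\<close> into
  \<open>z v* A\<close>, a form that none of the lemmas below match.\<close>

declare transpose_matrix_vector [simp del]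

section \<open>Coordinates of stacked vectors and block matrices\<close>

definition upper :: "'a^('m::finite + 'n::finite) \<Rightarrow> 'a^'m" where
  "upper z = (\<chi> i. z $ Inl i)"

definition lower :: "'a^('m::finite + 'n::finite) \<Rightarrow> 'a^'n" where
  "lower z = (\<chi> i. z $ Inr i)"

text \<open>For a stacked velocity \<open>v\<close>, this is the twist of agent \<open>k\<close>:
  its \<open>upper\<close> half is the linear velocity, its \<open>lower\<close> half the angular
  one.\<close>

definition block :: "'a^('n::finite \<times> 'm::finite) \<Rightarrow> 'n \<Rightarrow> 'a^'m" where
  "block v k = (\<chi> l. v $ (k, l))"

lemma sum_UNIV_plus:
  fixes f :: "'m::finite + 'n::finite \<Rightarrow> 'a::comm_monoid_add"
  shows "sum f UNIV = (\<Sum>i\<in>UNIV. f (Inl i)) + (\<Sum>j\<in>UNIV. f (Inr j))"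
  by (simp only: UNIV_Plus_UNIV[symmetric] sum.Plus finite o_def)

lemma sum_UNIV_pair:
  fixes f :: "'m::finite \<times> 'n::finite \<Rightarrow> 'a::comm_monoid_add"
  shows "sum f UNIV = (\<Sum>i\<in>UNIV. \<Sum>j\<in>UNIV. f (i, j))"
  by (simp only: UNIV_Times_UNIV[symmetric] sum.cartesian_product) simp

lemma upper_lower_eq_iff: "z = z' \<longleftrightarrow> upper z = upper z' \<and> lower z = lower z'"
  unfolding upper_def lower_def vec_eq_iff
  by (simp add: split_sum_all)

lemma upper_stack [simp]: "upper (stack a b) = a"
  and lower_stack [simp]: "lower (stack a b) = b"
  by (simp_all add: upper_def lower_def stack_def vec_eq_iff)

lemma upper_zero [simp]: "upper 0 = 0" and lower_zero [simp]: "lower 0 = 0"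
  by (simp_all add: upper_def lower_def vec_eq_iff)

lemma block_eq_iff: "v = v' \<longleftrightarrow> (\<forall>k. block v k = block v' k)"
  by (auto simp: block_def vec_eq_iff)

lemma stack_inner:
  fixes a :: "real^'m::finite" and b :: "real^'n::finite"
  shows "stack a b \<bullet> z = a \<bullet> upper z + b \<bullet> lower z"
  by (simp add: inner_vec_def sum_UNIV_plus stack_def upper_def lower_def)

lemma beside_mult_vec:
  fixes A :: "real^'m::finite^'r" and B :: "real^'n::finite^'r"
  shows "beside A B *v z = A *v upper z + B *v lower z"
  by (simp add: vec_eq_iff matrix_vector_mult_def beside_def sum_UNIV_plus stack_def
      upper_def lower_def)

lemma stack_mult_vec: "stack A B *v z = stack (A *v z) (B *v z)"
  by (auto simp: vec_eq_iff matrix_vector_mult_def stack_def split: sum.split)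

lemma minus_matrix_vector_mult: "(- A) *v z = - (A *v z)" for A :: "real^'n^'m"
  by (simp add: vec_eq_iff matrix_vector_mult_def sum_negf)

section \<open>The grasp matrix and rigid motions\<close>

lemma object_jacobian_mult_vec:
  "object_jacobian q p *v z = stack (upper z + cross3 (lower z) (p - q)) (lower z)"
  by (simp add: object_jacobian_def stack_mult_vec beside_mult_vec
      skew_mult_vec cross_skew[of "lower z"] minus_matrix_vector_mult)

lemma block_transpose_grasp_matrix:
  "block (transpose (grasp_matrix q x) *v z) i = object_jacobian q (fst (x i)) *v z"
  by (simp add: vec_eq_iff block_def matrix_vector_mult_def transpose_def grasp_matrix_def)

text \<open>A single agent suffices, as its Jacobian is unit block triangular. Hence the rigid
  motions have the same dimension at every configuration.\<close>

lemma inj_transpose_grasp_matrix: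
  fixes x :: "'n::finite \<Rightarrow> pose"
  shows "inj ((*v) (transpose (grasp_matrix q x)))"
proof (rule injI)
  fix z z'
  assume "transpose (grasp_matrix q x) *v z = transpose (grasp_matrix q x) *v z'"
  then have "object_jacobian q (fst (x i)) *v z = object_jacobian q (fst (x i)) *v z'" for i
    by (metis block_transpose_grasp_matrix)
  \<comment> \<open>Any agent will do; \<open>undefined\<close> names one because types are
    nonempty.\<close>
  from this[of undefined] show "z = z'"
    by (auto simp: object_jacobian_mult_vec upper_lower_eq_iff[of "stack _ _"] upper_lower_eq_iff[of z])
qed

text \<open>These are the rigid motions: \<open>a\<close> is the velocity of the object's center and
  \<open>b\<close> the common angular velocity.\<close>

lemma range_transpose_grasp_matrix:
  "v \<in> range ((*v) (transpose (grasp_matrix q x))) \<longleftrightarrow>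
    (\<exists>a b. \<forall>i. upper (block v i) = a + cross3 b (fst (x i) - q) \<and> lower (block v i) = b)"
  (is "?L \<longleftrightarrow> (\<exists>a b. ?R a b)")
proof
  assume ?L
  then obtain z where "v = transpose (grasp_matrix q x) *v z" by auto
  then have "?R (upper z) (lower z)"
    by (simp add: block_transpose_grasp_matrix object_jacobian_mult_vec)
  then show "\<exists>a b. ?R a b" by blast
next
  assume "\<exists>a b. ?R a b"
  then obtain a b where "?R a b" by blast
  then have "v = transpose (grasp_matrix q x) *v stack a b"
    by (simp add: block_eq_iff block_transpose_grasp_matrix object_jacobian_mult_vec upper_lower_eq_iff)
  then show ?L by blast
qed

section \<open>Action of the rigidity matrix on velocities\<close>

lemma rigidity_matrix_mult_vec:
  "rigidity_matrix \<epsilon>\<^sub>d \<epsilon>\<^sub>b x *v v =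
    stack (\<chi> e. \<Sum>k\<in>UNIV. distance_block x (\<epsilon>\<^sub>d e) k \<bullet> block v k)
          (\<chi> r. (\<Sum>k\<in>UNIV. bearing_block x (\<epsilon>\<^sub>b (fst r)) k *v block v k) $ snd r)"
  unfolding rigidity_matrix_def stack_mult_vec
  by (intro arg_cong2[where f = stack])
     (auto simp: vec_eq_iff matrix_vector_mult_def sum_UNIV_pair inner_vec_def block_def)

lemma sum_two_support:
  fixes f :: "'n::finite \<Rightarrow> 'a::comm_monoid_add"
  assumes "i \<noteq> j" "\<And>k. k \<noteq> i \<Longrightarrow> k \<noteq> j \<Longrightarrow> f k = 0"
  shows "sum f UNIV = f i + f j"
proof -
  have "sum f UNIV = sum f {i, j}"
    by (rule sum.mono_neutral_right) (use assms in auto)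
  then show ?thesis using assms by simp
qed

lemma sum_distance_block:
  assumes "i \<noteq> j"
  shows "(\<Sum>k\<in>UNIV. distance_block x (i, j) k \<bullet> block v k) =
    (fst (x j) - fst (x i)) \<bullet> (upper (block v j) - upper (block v i))"
  using assms
  by (subst sum_two_support[of i j])
     (auto simp: distance_block_def stack_inner inner_diff)

lemma outer_mult_vec:
  "((columnvector y :: real^1^'n) ** (rowvector y :: real^'n^1)) *v z = (y \<bullet> z) *\<^sub>R y"
proof -
  have "((columnvector y :: real^1^'n) ** (rowvector y :: real^'n^1)) $ i $ j = y $ i * y $ j" for i j
    by (simp add: matrix_matrix_mult_def rowvector_def columnvector_def)
  then show ?thesis
    by (simp add: vec_eq_iff matrix_vector_mult_def inner_vec_def sum_distrib_left sum_distrib_right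
        mult_ac)
qed

lemma proj_compl_mult_vec:
  "proj_compl y *v z = z - ((y \<bullet> z) / (norm y)\<^sup>2) *\<^sub>R y"
  by (simp add: proj_compl_def matrix_vector_mult_diff_rdistrib scaleR_matrix_vector_assoc[symmetric]
      outer_mult_vec)

lemma configuration_positions_distinct:
  "x \<in> configurations \<Longrightarrow> i \<noteq> j \<Longrightarrow> fst (x i) \<noteq> fst (x j)"
  by (auto simp: configurations_def inj_def)

lemma rotation_matrix_configuration:
  assumes "x \<in> configurations"
  shows "rotation_matrix (snd (x i))"
proof -
  have "x i \<in> SE3" using assms by (simp add: configurations_def)
  then show ?thesis by (cases "x i") (simp add: SE3_def)
qed

text \<open>The bearing is measured in the frame of agent \<open>i\<close>. Rotations respect inner
  and cross products, so the rotation factors out and leaves an expression in the world bearing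
  \<open>b\<close>.\<close>

lemma sum_bearing_block:
  fixes x :: "'n::finite \<Rightarrow> pose" and v :: "real^('n \<times> (3 + 3))"
  assumes "x \<in> configurations" "i \<noteq> j"
  defines "d \<equiv> norm (fst (x j) - fst (x i))"
    and "b \<equiv> (1 / norm (fst (x j) - fst (x i))) *\<^sub>R (fst (x j) - fst (x i))"
    and "z \<equiv> upper (block v j) - upper (block v i)"
  shows "(\<Sum>k\<in>UNIV. bearing_block x (i, j) k *v block v k) =
    transpose (snd (x i)) *v ((1 / d) *\<^sub>R (z - (b \<bullet> z) *\<^sub>R b) + cross3 b (lower (block v i)))"
proof -
  define T where "T = transpose (snd (x i))"
  have "rotation_matrix (snd (x i))"
    using assms(1) by (rule rotation_matrix_configuration)
  then have T: "rotation_matrix T" "orthogonal_matrix T"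
    by (auto simp: T_def rotation_matrix_def)
  then have iso: "(T *v a) \<bullet> (T *v c) = a \<bullet> c" for a c
  proof -
    have "orthogonal_transformation ((*v) T)"
      using T(2) by (simp add: orthogonal_transformation_matrix)
    then show ?thesis by (simp add: orthogonal_transformation_def)
  qed
  have "fst (x j) \<noteq> fst (x i)"
    using configuration_positions_distinct[OF assms(1,2)] by simp
  then have nb: "norm b = 1" by (simp add: b_def)
  have bear: "bearing x (i, j) = T *v b"
    by (simp add: bearing_def T_def b_def norm_minus_commute)
  have n1: "norm (T *v b) = 1"
    using nb by (simp add: norm_eq_sqrt_inner iso)
  define A where "A = ((1 / d) *\<^sub>R proj_compl (T *v b)) ** T"
  \<comment> \<open>Since \<open>T\<close> is an isometry, projecting \<open>T *v c\<close> off
    \<open>T *v b\<close> is the same as projecting first and rotating afterwards.\<close>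
  have A: "A *v c = T *v ((1 / d) *\<^sub>R (c - (b \<bullet> c) *\<^sub>R b))" for c
    by (simp add: A_def matrix_vector_mul_assoc[symmetric] scaleR_matrix_vector_assoc[symmetric]
        proj_compl_mult_vec n1 iso matrix_vector_mult_diff_distrib matrix_vector_mult_scaleR)
  have bi: "bearing_block x (i, j) i = beside (- A) (skew (T *v b) ** T)"
    unfolding bearing_block_def A_def d_def by (simp add: Let_def bear T_def)
  have bj: "bearing_block x (i, j) j = beside A 0"
    using not_sym[OF assms(2)]
    unfolding bearing_block_def A_def d_def by (simp add: Let_def bear T_def)
  have "(\<Sum>k\<in>UNIV. bearing_block x (i, j) k *v block v k) =
      bearing_block x (i, j) i *v block v i + bearing_block x (i, j) j *v block v j"
    by (rule sum_two_support) (use assms(2) in \<open>auto simp: bearing_block_def Let_def\<close>)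
  also have "\<dots> = A *v z + cross3 (T *v b) (T *v lower (block v i))"
    unfolding bi bj beside_mult_vec minus_matrix_vector_mult z_def matrix_vector_mult_diff_distrib
    by (simp add: matrix_vector_mul_assoc[symmetric] skew_mult_vec)
  \<comment> \<open>Determinant one matters here: a reflection would flip the sign of the cross
    product.\<close>
  also have "\<dots> = T *v ((1 / d) *\<^sub>R (z - (b \<bullet> z) *\<^sub>R b) + cross3 b (lower (block v i)))"
    by (simp add: A cross_rotation_matrix[OF T(1)] matrix_vector_right_distrib)
  finally show ?thesis by (simp add: T_def)
qed

text \<open>The distance equation removes the component of \<open>z\<close> along \<open>a\<close>,
  so the projection disappears and the bearing equation can be solved for \<open>z\<close>.
  Conversely, \<open>cross3 w a\<close> is orthogonal to \<open>a\<close>.\<close>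

lemma edge_constraints_iff:
  fixes a z w :: "real^3"
  assumes "a \<noteq> 0"
  defines "d \<equiv> norm a" and "b \<equiv> (1 / norm a) *\<^sub>R a"
  shows "a \<bullet> z = 0 \<and> (1 / d) *\<^sub>R (z - (b \<bullet> z) *\<^sub>R b) + cross3 b w = 0 \<longleftrightarrow> z = cross3 w a"
proof -
  have d: "d > 0" and ab: "a = d *\<^sub>R b" using assms by auto
  have "(1 / d) *\<^sub>R z + cross3 b w = (1 / d) *\<^sub>R (z - cross3 w a)"
    using d by (simp add: ab cross_mult_right scaleR_diff_right scaleR_add_right cross_skew[of w b])
  then have *: "(1 / d) *\<^sub>R z + cross3 b w = 0 \<longleftrightarrow> z = cross3 w a"
    using d by simp
  have "a \<bullet> z = 0 \<longleftrightarrow> b \<bullet> z = 0" using d by (simp add: ab)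
  moreover have "z = cross3 w a \<Longrightarrow> a \<bullet> z = 0" by (simp add: dot_cross_self)
  ultimately show ?thesis using * by auto
qed

section \<open>The kernel of the rigidity matrix\<close>

lemma ker_rigidity_matrix:
  fixes x :: "'n::{finite, linorder} \<Rightarrow> pose"
  assumes "x \<in> configurations"
    and d: "bij_betw \<epsilon>\<^sub>d UNIV undirected_edges"
    and b: "bij_betw \<epsilon>\<^sub>b UNIV edges"
  shows "rigidity_matrix \<epsilon>\<^sub>d \<epsilon>\<^sub>b x *v v = 0 \<longleftrightarrow>
    (\<forall>i j. i \<noteq> j \<longrightarrow> upper (block v j) - upper (block v i) =
      cross3 (lower (block v i)) (fst (x j) - fst (x i)))"
proof -
  let ?D = "\<lambda>e. \<Sum>k\<in>UNIV. distance_block x e k \<bullet> block v k"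
  let ?B = "\<lambda>e. \<Sum>k\<in>UNIV. bearing_block x e k *v block v k"
  have inj: "fst (x j) - fst (x i) \<noteq> 0" if "i \<noteq> j" for i j
    using configuration_positions_distinct[OF assms(1) that] by simp
  \<comment> \<open>Distance rows exist only for \<open>i < j\<close>; symmetry extends their
    constraint to both orientations of an edge.\<close>
  have sym: "?D (i, j) = ?D (j, i)" if "i \<noteq> j" for i j
    using that by (simp add: sum_distance_block inner_diff)
  have inv: "transpose (snd (x i)) *v c = 0 \<longleftrightarrow> c = 0" for i c
  proof -
    have "rotation_matrix (snd (x i))"
      using assms(1) by (rule rotation_matrix_configuration)
    then have "snd (x i) ** transpose (snd (x i)) = mat 1"
      by (simp add: rotation_matrix_def orthogonal_matrix_def)
    then show ?thesis
      by (metis matrix_vector_mul_assoc matrix_vector_mul_lid matrix_vector_mult_0_right)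
  qed
  have edge: "?D (i, j) = 0 \<and> ?B (i, j) = 0 \<longleftrightarrow> upper (block v j) - upper (block v i) =
      cross3 (lower (block v i)) (fst (x j) - fst (x i))" if "i \<noteq> j" for i j
    unfolding sum_distance_block[OF that] sum_bearing_block[OF assms(1) that] inv
    by (rule edge_constraints_iff[OF inj[OF that]])
  have "rigidity_matrix \<epsilon>\<^sub>d \<epsilon>\<^sub>b x *v v = 0 \<longleftrightarrow> (\<forall>e. ?D (\<epsilon>\<^sub>d e) = 0) \<and> (\<forall>e. ?B (\<epsilon>\<^sub>b e) = 0)"
    unfolding rigidity_matrix_mult_vec upper_lower_eq_iff by (simp add: vec_eq_iff)
  also have "\<dots> \<longleftrightarrow> (\<forall>e\<in>undirected_edges. ?D e = 0) \<and> (\<forall>e\<in>edges. ?B e = 0)"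
    unfolding bij_betw_imp_surj_on[OF d, symmetric] bij_betw_imp_surj_on[OF b, symmetric] by simp
  also have "\<dots> \<longleftrightarrow> (\<forall>i j. i \<noteq> j \<longrightarrow> ?D (i, j) = 0 \<and> ?B (i, j) = 0)"
  proof -
    have "?D (i, j) = 0" if "\<forall>e\<in>undirected_edges. ?D e = 0" "i \<noteq> j" for i j
      using that sym[of i j] by (cases i j rule: linorder_cases) (auto simp: undirected_edges_def)
    then show ?thesis
      by (auto simp: undirected_edges_def edges_def)
  qed
  also have "\<dots> \<longleftrightarrow> (\<forall>i j. i \<noteq> j \<longrightarrow> upper (block v j) - upper (block v i) =
      cross3 (lower (block v i)) (fst (x j) - fst (x i)))"
    by (intro all_cong1 imp_cong refl edge)
  finally show ?thesis .
qed

text \<open>In the difference of two linear velocities of a rigid motion, both \<open>a\<close> and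
  the reference point \<open>q\<close> cancel.\<close>

lemma range_transpose_grasp_matrix_subset_ker:
  fixes x :: "'n::{finite, linorder} \<Rightarrow> pose"
  assumes "x \<in> configurations"
    and "bij_betw \<epsilon>\<^sub>d UNIV undirected_edges"
    and "bij_betw \<epsilon>\<^sub>b UNIV edges"
  shows "range ((*v) (transpose (grasp_matrix q x))) \<subseteq> {v. rigidity_matrix \<epsilon>\<^sub>d \<epsilon>\<^sub>b x *v v = 0}"
proof
  fix v
  assume "v \<in> range ((*v) (transpose (grasp_matrix q x)))"
  then obtain a b where
    "\<And>i. upper (block v i) = a + cross3 b (fst (x i) - q)" "\<And>i. lower (block v i) = b"
    unfolding range_transpose_grasp_matrix by blast
  then show "v \<in> {v. rigidity_matrix \<epsilon>\<^sub>d \<epsilon>\<^sub>b x *v v = 0}"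
    by (simp add: ker_rigidity_matrix[OF assms] Cross3.right_diff_distrib)
qed

text \<open>The two orientations of edge \<open>i\<close>, \<open>j\<close> make
  \<open>s = w j - w i\<close> parallel to \<open>a\<close>; comparing the path from
  \<open>i\<close> over \<open>j\<close> to \<open>k\<close> with the direct edge makes it parallel
  to \<open>b\<close>. As \<open>a\<close> and \<open>b\<close> are independent, \<open>s\<close>
  vanishes.\<close>

lemma angular_velocities_equal:
  fixes p u w :: "'n \<Rightarrow> real^3"
  assumes uw: "\<And>i j. i \<noteq> j \<Longrightarrow> u j - u i = cross3 (w i) (p j - p i)"
    and "i \<noteq> j" "j \<noteq> k" "i \<noteq> k"
    and nc: "cross3 (p j - p i) (p k - p i) \<noteq> 0"
  shows "w i = w j"
proof -
  define a b where "a = p j - p i" and "b = p k - p i"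
  define s where "s = w j - w i"
  have ab: "p i - p j = - a" "p k - p j = b - a"
    by (simp_all add: a_def b_def)
  have "cross3 (w j) a = cross3 (w i) a"
    using uw[of i j] uw[of j i] assms(2)
    by (simp add: ab a_def[symmetric]) (metis add.inverse_inverse minus_diff_eq)
  then have sa: "cross3 s a = 0" by (simp add: s_def Cross3.left_diff_distrib)
  have "u k - u j = (u k - u i) - (u j - u i)" by simp
  then have "cross3 (w j) (b - a) = cross3 (w i) b - cross3 (w i) a"
    using assms by (metis a_def b_def ab(2))
  then have "cross3 s b = cross3 s a"
    by (simp add: s_def Cross3.left_diff_distrib Cross3.right_diff_distrib algebra_simps)
  with sa have sb: "cross3 s b = 0" by simp
  have "s = 0"
  proof (rule ccontr)
    assume "s \<noteq> 0"
    then have "s \<bullet> s \<noteq> 0" by simp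
    \<comment> \<open>By the triple product expansion of \<open>cross3 s (cross3 s a)\<close>, both
      \<open>a\<close> and \<open>b\<close> would be multiples of \<open>s\<close>, hence
      parallel.\<close>
    moreover have "(s \<bullet> s) *\<^sub>R a = (s \<bullet> a) *\<^sub>R s" "(s \<bullet> s) *\<^sub>R b = (s \<bullet> b) *\<^sub>R s"
      using Lagrange[of s s a] Lagrange[of s s b] sa sb by simp_all
    then have "cross3 ((s \<bullet> s) *\<^sub>R a) ((s \<bullet> s) *\<^sub>R b) = 0"
      by (simp add: cross_mult_left cross_mult_right)
    ultimately show False
      using nc by (simp add: a_def[symmetric] b_def[symmetric] cross_mult_left cross_mult_right)
  qed
  then show ?thesis by (simp add: s_def)
qed

lemma ker_subset_range_transpose_grasp_matrix:
  fixes x :: "'n::{finite, linorder} \<Rightarrow> pose"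
  assumes "x \<in> configurations"
    and "bij_betw \<epsilon>\<^sub>d UNIV undirected_edges"
    and "bij_betw \<epsilon>\<^sub>b UNIV edges"
    and nc: "\<And>i j. i \<noteq> j \<Longrightarrow>
      \<exists>k. cross3 (fst (x j) - fst (x i)) (fst (x k) - fst (x i)) \<noteq> 0"
  shows "{v. rigidity_matrix \<epsilon>\<^sub>d \<epsilon>\<^sub>b x *v v = 0} \<subseteq> range ((*v) (transpose (grasp_matrix q x)))"
proof
  fix v
  assume "v \<in> {v. rigidity_matrix \<epsilon>\<^sub>d \<epsilon>\<^sub>b x *v v = 0}"
  then have uw: "upper (block v j) - upper (block v i) =
      cross3 (lower (block v i)) (fst (x j) - fst (x i))" if "i \<noteq> j" for i j
    using that by (simp add: ker_rigidity_matrix[OF assms(1-3)])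
  have w: "lower (block v i) = lower (block v j)" for i j
  proof (cases "i = j")
    case False
    then obtain k where k: "cross3 (fst (x j) - fst (x i)) (fst (x k) - fst (x i)) \<noteq> 0"
      using nc by blast
    then have "k \<noteq> i" "k \<noteq> j" by auto
    with angular_velocities_equal[of "\<lambda>i. upper (block v i)" "\<lambda>i. lower (block v i)"
        "\<lambda>i. fst (x i)" i j k, OF uw] False k
    show ?thesis by auto
  qed simp
  \<comment> \<open>An arbitrary reference agent. Its twist determines the motion, and
    \<open>a\<close> below is its linear velocity transported to the point \<open>q\<close>.\<close>
  define o' :: 'n where "o' = undefined"
  define b where "b = lower (block v o')"
  define a where "a = upper (block v o') - cross3 b (fst (x o') - q)"
  have "upper (block v i) = a + cross3 b (fst (x i) - q)" for i
  proof (cases "i = o'")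
    case False
    then have "upper (block v i) = upper (block v o') + cross3 b (fst (x i) - fst (x o'))"
      using uw[of o' i] by (simp add: b_def algebra_simps)
    then show ?thesis by (simp add: a_def Cross3.right_diff_distrib)
  qed (simp add: a_def)
  moreover have "lower (block v i) = b" for i
    unfolding b_def by (rule w)
  ultimately show "v \<in> range ((*v) (transpose (grasp_matrix q x)))"
    unfolding range_transpose_grasp_matrix by blast
qed

text \<open>Supplies the configuration with which one of maximal rank is compared.\<close>

lemma noncollinear_configuration_exists:
  assumes "CARD('n::finite) \<ge> 3"
  obtains y :: "'n::finite \<Rightarrow> pose" where "y \<in> configurations"
    "\<forall>i j. i \<noteq> j \<longrightarrow> (\<exists>k. cross3 (fst (y j) - fst (y i)) (fst (y k) - fst (y i)) \<noteq> 0)"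
proof
  \<comment> \<open>Enumerating the finite type gives the agents distinct real parameters.\<close>
  define t :: "'n \<Rightarrow> real" where "t i = real (to_nat i)" for i
  have t: "t i = t j \<longleftrightarrow> i = j" for i j by (simp add: t_def)
  \<comment> \<open>No three points of a parabola are collinear.\<close>
  define y :: "'n \<Rightarrow> pose" where "y i = (vector [t i, (t i)\<^sup>2, 0], mat 1)" for i
  have "inj (\<lambda>i. fst (y i))"
  proof (rule injI)
    fix i j
    assume "fst (y i) = fst (y j)"
    then have "fst (y i) $ 1 = fst (y j) $ 1" by simp
    then show "i = j" by (simp add: y_def t)
  qed
  then show "y \<in> configurations"
    by (simp add: configurations_def SE3_def y_def rotation_matrix_def orthogonal_matrix_id)
  show "\<forall>i j. i \<noteq> j \<longrightarrow> (\<exists>k. cross3 (fst (y j) - fst (y i)) (fst (y k) - fst (y i)) \<noteq> 0)"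
  proof (intro allI impI)
    fix i j :: 'n
    assume "i \<noteq> j"
    \<comment> \<open>At least three agents leave a third one outside the pair.\<close>
    then have "card {i, j} = 2" by simp
    with assms have "{i, j} \<noteq> UNIV" by force
    then obtain k where k: "k \<noteq> i" "k \<noteq> j" by blast
    \<comment> \<open>On the parabola the third component is a Vandermonde determinant.\<close>
    have "cross3 (fst (y j) - fst (y i)) (fst (y k) - fst (y i)) $ 3 =
        (t j - t i) * (t k - t i) * (t k - t j)"
      by (simp add: y_def cross3_def power2_eq_square algebra_simps)
    also have "\<dots> \<noteq> 0" using k \<open>i \<noteq> j\<close> by (simp add: t)
    finally show "\<exists>k. cross3 (fst (y j) - fst (y i)) (fst (y k) - fst (y i)) \<noteq> 0"
      by (metis zero_index)
  qed
qed

section \<open>Orthogonal complements and rank-nullity\<close>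

lemma ker_matrix_eq_orthogonal_comp:
  fixes A :: "real^'n^'m"
  shows "{v. A *v v = 0} = (range ((*v) (transpose A)))\<^sup>\<bottom>"
  using ker_orthogonal_comp_adjoint[OF matrix_vector_mul_linear[of A]]
  by (auto simp: adjoint_matrix)

lemma orthogonal_comp_ker_matrix:
  fixes A :: "real^'n^'m"
  shows "{v. A *v v = 0}\<^sup>\<bottom> = range ((*v) (transpose A))"
  unfolding ker_matrix_eq_orthogonal_comp
  by (intro orthogonal_comp_self linear_subspace_image) auto

lemma dim_ker_plus_rank:
  fixes A :: "real^'n^'m"
  shows "dim {v. A *v v = 0} + rank A = CARD('n)"
proof -
  have "dim ((range ((*v) (transpose A)))\<^sup>\<bottom>) + dim (range ((*v) (transpose A))) = CARD('n)"
    using dim_subspace_orthogonal_to_vectors[of "range ((*v) (transpose A))" UNIV]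
    by (simp add: orthogonal_comp_def linear_subspace_image)
  then show ?thesis
    by (metis ker_matrix_eq_orthogonal_comp rank_dim_range rank_transpose)
qed

section \<open>Configurations of maximal rank\<close>

lemma ker_rigidity_matrix_of_max_rank:
  fixes x :: "'n::{finite, linorder} \<Rightarrow> pose"
    and p\<^sub>O :: "real^3"
    and \<epsilon>\<^sub>d :: "'d::finite \<Rightarrow> 'n \<times> 'n"
    and \<epsilon>\<^sub>b :: "'b::finite \<Rightarrow> 'n \<times> 'n"
  assumes "CARD('n) \<ge> 3"
    and "x \<in> configurations"
    and "bij_betw \<epsilon>\<^sub>d UNIV undirected_edges"
    and "bij_betw \<epsilon>\<^sub>b UNIV edges"
    and "rank (rigidity_matrix \<epsilon>\<^sub>d \<epsilon>\<^sub>b x) =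
           Max ((\<lambda>y. rank (rigidity_matrix \<epsilon>\<^sub>d \<epsilon>\<^sub>b y)) ` configurations)"
  shows "{v. rigidity_matrix \<epsilon>\<^sub>d \<epsilon>\<^sub>b x *v v = 0} = range ((*v) (transpose (grasp_matrix p\<^sub>O x)))"
proof -
  let ?R = "rigidity_matrix \<epsilon>\<^sub>d \<epsilon>\<^sub>b :: ('n \<Rightarrow> pose) \<Rightarrow> _"
  let ?G = "grasp_matrix p\<^sub>O :: ('n \<Rightarrow> pose) \<Rightarrow> _"
  obtain y :: "'n \<Rightarrow> pose" where y: "y \<in> configurations"
    "\<forall>i j. i \<noteq> j \<longrightarrow> (\<exists>k. cross3 (fst (y j) - fst (y i)) (fst (y k) - fst (y i)) \<noteq> 0)"
    by (rule noncollinear_configuration_exists[OF assms(1)])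
  \<comment> \<open>There are infinitely many configurations, but ranks are bounded by the number of
    columns, so \<open>Max\<close> ranges over a finite set.\<close>
  have "(\<lambda>y. rank (?R y)) ` configurations \<subseteq> {..CARD('n \<times> (3 + 3))}"
    by (intro image_subsetI, unfold atMost_iff) (rule order_trans[OF rank_bound min.cobounded2])
  then have "finite ((\<lambda>y. rank (?R y)) ` configurations)"
    using finite_subset by blast
  then have "rank (?R y) \<le> rank (?R x)"
    using y(1) unfolding assms(5) by (intro Max_ge) auto
  then have "dim {v. ?R x *v v = 0} \<le> dim {v. ?R y *v v = 0}"
    using dim_ker_plus_rank[of "?R x"] dim_ker_plus_rank[of "?R y"] by linarith
  also have "\<dots> \<le> dim (range ((*v) (transpose (?G y))))"
    by (intro dim_subset ker_subset_range_transpose_grasp_matrix y(1) y(2)[rule_format] assms(3,4))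
  \<comment> \<open>Both transposed grasp matrices are injective on the same six-dimensional
    space.\<close>
  also have "\<dots> = dim (range ((*v) (transpose (?G x))))"
    using inj_transpose_grasp_matrix[of p\<^sub>O x] inj_transpose_grasp_matrix[of p\<^sub>O y]
    by (metis full_rank_injective rank_dim_range)
  finally have dim_le: "dim {v. ?R x *v v = 0} \<le> dim (range ((*v) (transpose (?G x))))" .
  have "subspace {v. ?R x *v v = 0}"
    unfolding ker_matrix_eq_orthogonal_comp by (rule subspace_orthogonal_comp)
  \<comment> \<open>A subspace contained in another of no larger dimension equals it.\<close>
  with dim_le have "range ((*v) (transpose (?G x))) = {v. ?R x *v v = 0}"
    by (intro subspace_dim_equal range_transpose_grasp_matrix_subset_ker assms(2-4)
        matrix_vector_mul_linear linear_subspace_image subspace_UNIV)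
  then show ?thesis by (rule sym)
qed

theorem theorem1:
  fixes x :: "'n::{finite, linorder} \<Rightarrow> pose"
    and p\<^sub>O :: "real^3"
    and \<epsilon>\<^sub>d :: "'d::finite \<Rightarrow> 'n \<times> 'n"
    and \<epsilon>\<^sub>b :: "'b::finite \<Rightarrow> 'n \<times> 'n"
  assumes "CARD('n) \<ge> 3"
    and "x \<in> configurations"
    and "bij_betw \<epsilon>\<^sub>d UNIV undirected_edges"
    and "bij_betw \<epsilon>\<^sub>b UNIV edges"
    and "rank (rigidity_matrix \<epsilon>\<^sub>d \<epsilon>\<^sub>b x) =
           Max ((\<lambda>y. rank (rigidity_matrix \<epsilon>\<^sub>d \<epsilon>\<^sub>b y)) ` configurations)"
  shows "{v. grasp_matrix p\<^sub>O x *v v = 0} =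
         range (\<lambda>w. transpose (rigidity_matrix \<epsilon>\<^sub>d \<epsilon>\<^sub>b x) *v w)"
  \<comment> \<open>The null space of the grasp matrix is the complement of the rigid motions, that
    is, of the kernel of the rigidity matrix; this complement is the row space of the
    latter.\<close>
  unfolding ker_matrix_eq_orthogonal_comp[of "grasp_matrix p\<^sub>O x"]
    ker_rigidity_matrix_of_max_rank[OF assms, symmetric]
  by (rule orthogonal_comp_ker_matrix)

end
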